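(* Let $n$ be a positive integer and let $\mathcal{A}$ be an alphabet of $k=k_v+k_c$ letters, partitioned into a set of $k_v$ "vowels" and a set of $k_c$ "consonants". Call an $n$-letter word $a_1a_2\dots a_n$ over $\mathcal{A}$ class alternating if for every $1\le i\le n-1$, exactly one of $a_i,a_{i+1}$ is a vowel (i.e., vowels and consonants alternate). If either $n$ is even, or $n$ is odd and $k_v=k_c$, then there exists a universal cycle (U-cycle) for the set of class alternating $n$-letter words over $\mathcal{A}$.
   Context: For a set $\mathcal{C}$ of $n$-letter words over an alphabet, a universal cycle (U-cycle) for $\mathcal{C}$ is a cyclic sequence $x_1x_2\dots x_N$ with $N=|\mathcal{C}|$ such that the $N$ words $x_ix_{i+1}\dots x_{i+n-1}$ ($1\le i\le N$, indices taken modulo $N$) are exactly the words of $\mathcal{C}$, each occurring exactly once. *)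

theory Defs
  imports Main
begin

text \<open>Words are lists and cyclic sequences are lists read modulo their length; positions
  are counted from 0.\<close>

definition cyclic_factor :: "nat \<Rightarrow> 'a list \<Rightarrow> nat \<Rightarrow> 'a list" where
  "cyclic_factor n xs i = map (\<lambda>j. xs ! ((i + j) mod length xs)) [0..<n]"

text \<open>The word length \<open>n\<close> may exceed \<open>length xs\<close>, in which case a factor wraps around the
  cycle several times. For an empty set of words, the empty cycle is a universal cycle.\<close>

definition universal_cycle :: "nat \<Rightarrow> 'a list set \<Rightarrow> 'a list \<Rightarrow> bool" where
  "universal_cycle n W xs \<longleftrightarrow>
     length xs = card W \<and> bij_betw (cyclic_factor n xs) {..<length xs} W"

definition class_alternating :: "'a set \<Rightarrow> 'a list \<Rightarrow> bool" where
  "class_alternating V w \<longleftrightarrow>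
     (\<forall>i. i + 1 < length w \<longrightarrow> (w ! i \<in> V) \<noteq> (w ! (i + 1) \<in> V))"

definition class_alternating_words :: "nat \<Rightarrow> 'a set \<Rightarrow> 'a set \<Rightarrow> 'a list set" where
  "class_alternating_words n A V =
     {w. length w = n \<and> set w \<subseteq> A \<and> class_alternating V w}"

end

theory Submission
  imports Defs "Graph_Theory.Euler"
begin

text \<open>Take the words of length \<open>n\<close> as arcs from their prefix to their suffix of length
  \<open>n - 1\<close>. A closed Euler trail of this digraph, read off through the first letters of its arcs,
  is a universal cycle. For class alternating words, the arcs into \<open>u\<close> are determined by a letter
  in the class opposite to that of the first letter of \<open>u\<close>, and the arcs out of \<open>u\<close> by a letter
  in the class opposite to that of the last letter of \<open>u\<close>. If \<open>n\<close> is even, these are the same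
  class, otherwise they are different classes, so the hypothesis makes all degrees balanced.
  The digraph is connected because two alternating words can be concatenated, if necessary with
  one separating letter.\<close>

text \<open>Arcs are the words themselves, so an Euler trail lists \<open>W\<close> without
  repetition. Only occurring prefixes and suffixes are vertices, so none is isolated.\<close>

definition overlap_digraph :: "'a list set \<Rightarrow> ('a list, 'a list) pre_digraph" where
  "overlap_digraph W = \<lparr>verts = butlast ` W \<union> tl ` W, arcs = W, tail = butlast, head = tl\<rparr>"

lemma overlap_digraph_simps [simp]:
  "verts (overlap_digraph W) = butlast ` W \<union> tl ` W"
  "arcs (overlap_digraph W) = W"
  "tail (overlap_digraph W) = butlast"
  "head (overlap_digraph W) = tl"
  by (simp_all add: overlap_digraph_def)

lemma fin_digraph_overlap_digraph: "finite W \<Longrightarrow> fin_digraph (overlap_digraph W)"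
  by unfold_locales auto

lemma (in pre_digraph) cas_imp_successively:
  assumes "cas u p v"
  shows "successively (\<lambda>e f. head G e = tail G f) p"
    and "p \<noteq> [] \<Longrightarrow> tail G (hd p) = u \<and> head G (last p) = v"
  using assms by (induction p arbitrary: u) (fastforce simp: successively_Cons)+

text \<open>Successive arcs overlap in all but one letter, so letter \<open>j\<close> of an arc is
  the first letter of the arc \<open>j\<close> places further round the cycle.\<close>

lemma universal_cycle_of_euler_trail:
  assumes len: "\<And>w. w \<in> W \<Longrightarrow> length w = n" and "n > 0" "W \<noteq> {}"
    and trail: "pre_digraph.euler_trail (overlap_digraph W) u p u"
  shows "universal_cycle n W (map hd p)"
proof -
  interpret G: pre_digraph "overlap_digraph W" .
  have dist: "distinct p" and set_p: "set p = W" and cas: "G.cas u p u"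
    using trail by (auto simp: G.euler_trail_def G.trail_def G.awalk_def)
  define N where "N = length p"
  have "p \<noteq> []" using set_p \<open>W \<noteq> {}\<close> by auto
  then have "N > 0" by (simp add: N_def)
  \<comment> \<open>The periodic extension of \<open>p\<close> lets the induction for
    \<open>nth_f\<close> run past the end of the list.\<close>
  define f where "f i = p ! (i mod N)" for i
  have f_in: "f i \<in> W" for i
    using \<open>N > 0\<close> set_p by (auto simp: f_def N_def)
  have succ: "successively (\<lambda>e f. tl e = butlast f) p"
    and ends: "butlast (hd p) = u" "tl (last p) = u"
    using G.cas_imp_successively[OF cas] \<open>p \<noteq> []\<close> by simp_all
  have step: "tl (f i) = butlast (f (Suc i))" for i
  proof (cases "Suc (i mod N) = N")
    case True
    \<comment> \<open>At the wrap-around, the overlap comes from the trail being closed.\<close>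
    then have "i mod N = N - 1" by simp
    with True have "f i = last p" "f (Suc i) = hd p"
      using \<open>p \<noteq> []\<close> by (auto simp: f_def N_def last_conv_nth hd_conv_nth mod_Suc)
    with ends show ?thesis by simp
  next
    case False
    then have "Suc (i mod N) < N"
      using \<open>N > 0\<close> by (metis Suc_lessI mod_less_divisor)
    with False succ show ?thesis
      by (auto simp: f_def N_def mod_Suc successively_conv_nth)
  qed
  have nth_f: "f i ! j = hd (f (i + j))" if "j < n" for i j
    using that
  proof (induction j arbitrary: i)
    case 0
    then show ?case using len[OF f_in[of i]] by (auto simp: hd_conv_nth)
  next
    case (Suc j)
    have "f i ! Suc j = tl (f i) ! j"
      using Suc.prems len[OF f_in[of i]] by (simp add: nth_tl)
    also have "\<dots> = f (Suc i) ! j"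
      using Suc.prems len[OF f_in[of "Suc i"]] by (simp add: step nth_butlast)
    finally show ?case using Suc by simp
  qed
  have "cyclic_factor n (map hd p) i = p ! i" if "i < length p" for i
  proof (rule nth_equalityI)
    have fi: "f i = p ! i" using that by (simp add: f_def N_def)
    then show "length (cyclic_factor n (map hd p) i) = length (p ! i)"
      using len[OF f_in[of i]] by (simp add: cyclic_factor_def)
    fix j assume "j < length (cyclic_factor n (map hd p) i)"
    then have "j < n" by (simp add: cyclic_factor_def)
    then show "cyclic_factor n (map hd p) i ! j = p ! i ! j"
      using nth_f[of j i] fi \<open>p \<noteq> []\<close> by (simp add: cyclic_factor_def f_def N_def)
  qed
  moreover have "bij_betw ((!) p) {..<length p} W"
    using bij_betw_nth[OF dist refl set_p[symmetric]] .
  ultimately have "bij_betw (cyclic_factor n (map hd p)) {..<length p} W"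
    by (subst bij_betw_cong[where g = "(!) p"]) auto
  moreover have "length p = card W"
    using dist set_p distinct_card by metis
  ultimately show ?thesis by (simp add: universal_cycle_def)
qed

text \<open>Euler's theorem with degrees counted by letters: arcs into \<open>u\<close> are words
  \<open>a # u\<close>, arcs out of \<open>u\<close> are words \<open>u @ [b]\<close>. The empty
  \<open>W\<close> is split off, as a digraph without vertices is not strongly connected.\<close>

lemma universal_cycle_exists:
  assumes "finite W" and len: "\<And>w. w \<in> W \<Longrightarrow> length w = n" and "n > 0"
    and conn: "W \<noteq> {} \<Longrightarrow> strongly_connected (overlap_digraph W)"
    and deg: "\<And>u. u \<in> butlast ` W \<union> tl ` W \<Longrightarrow>
      card {a. a # u \<in> W} = card {b. u @ [b] \<in> W}"
  shows "\<exists>xs. universal_cycle n W xs"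
proof (cases "W = {}")
  case True
  then have "universal_cycle n W []" by (simp add: universal_cycle_def bij_betw_def)
  then show ?thesis ..
next
  case False
  interpret G: fin_digraph "overlap_digraph W"
    using \<open>finite W\<close> by (rule fin_digraph_overlap_digraph)
  have ne: "w \<noteq> []" if "w \<in> W" for w using len[OF that] \<open>n > 0\<close> by auto
  have "\<forall>u \<in> verts (overlap_digraph W).
      in_degree (overlap_digraph W) u = out_degree (overlap_digraph W) u"
  proof
    fix u assume "u \<in> verts (overlap_digraph W)"
    have "in_arcs (overlap_digraph W) u = (\<lambda>a. a # u) ` {a. a # u \<in> W}"
      using ne by (force simp: in_arcs_def image_iff neq_Nil_conv)
    moreover have "out_arcs (overlap_digraph W) u = (\<lambda>b. u @ [b]) ` {b. u @ [b] \<in> W}"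
      using ne by (auto simp: out_arcs_def image_iff) (metis append_butlast_last_id)
    ultimately show "in_degree (overlap_digraph W) u = out_degree (overlap_digraph W) u"
      using deg[of u] \<open>u \<in> verts (overlap_digraph W)\<close>
      by (simp add: in_degree_def out_degree_def card_image inj_on_def)
  qed
  moreover have "connected (overlap_digraph W)"
    \<comment> \<open>\<open>connected\<close> refers to the symmetric closure, to which directed
      reachability carries over.\<close>
    using conn[OF False]
    by (intro G.connectedI G.reachable_mk_symmetricI) (unfold strongly_connected_def, blast+)
  ultimately obtain u p where "G.euler_trail u p u"
    using G.closed_euler1 by blast
  then show ?thesis
    using universal_cycle_of_euler_trail[OF len \<open>n > 0\<close> False] by blast
qed

lemma class_alternating_iff_successively:
  "class_alternating V w \<longleftrightarrow> successively (\<lambda>a b. (a \<in> V) \<noteq> (b \<in> V)) w"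
  by (simp add: class_alternating_def successively_conv_nth)

lemma class_alternating_Nil [simp]: "class_alternating V []"
  by (simp add: class_alternating_def)

lemma class_alternating_Cons:
  "class_alternating V (a # w) \<longleftrightarrow>
     w = [] \<or> (a \<in> V) \<noteq> (hd w \<in> V) \<and> class_alternating V w"
  by (auto simp: class_alternating_iff_successively successively_Cons)

lemma class_alternating_append:
  "class_alternating V (u @ v) \<longleftrightarrow> class_alternating V u \<and> class_alternating V v \<and>
     (u = [] \<or> v = [] \<or> (last u \<in> V) \<noteq> (hd v \<in> V))"
  by (auto simp: class_alternating_iff_successively successively_append_iff)

text \<open>The class flips \<open>length w - 1\<close> times between the two ends.\<close>

lemma class_alternating_hd_last:
  assumes "class_alternating V w" "w \<noteq> []"
  shows "((hd w \<in> V) = (last w \<in> V)) = odd (length w)"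
  using assms by (induction w) (auto simp: class_alternating_Cons)

lemma finite_class_alternating_words:
  "finite A \<Longrightarrow> finite (class_alternating_words n A V)"
  by (rule finite_subset[OF _ finite_lists_length_eq[of A n]])
     (auto simp: class_alternating_words_def)

text \<open>Equality can fail: if all letters lie in one class, there are one-letter words but none
  of two letters.\<close>

lemma verts_overlap_digraph_class_alternating_words:
  "butlast ` class_alternating_words (Suc m) A V \<union> tl ` class_alternating_words (Suc m) A V
     \<subseteq> class_alternating_words m A V"
proof -
  have "butlast w \<in> class_alternating_words m A V \<and> tl w \<in> class_alternating_words m A V"
    if w: "w \<in> class_alternating_words (Suc m) A V" for w
  proof -
    have "w \<noteq> []" using w by (auto simp: class_alternating_words_def)
    then have "class_alternating V (butlast w)" "class_alternating V (tl w)"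
      using w class_alternating_append[of V "butlast w" "[last w]"]
        class_alternating_Cons[of V "hd w" "tl w"]
      by (auto simp: class_alternating_words_def)
    then show ?thesis
      using w by (auto simp: class_alternating_words_def dest: in_set_butlastD list.set_sel(2)[rotated])
  qed
  then show ?thesis by blast
qed

text \<open>A window of length \<open>m\<close> slides along \<open>w\<close>; each shift by one
  letter follows the arc given by the \<open>m + 1\<close> letters involved.\<close>

lemma overlap_walk_class_alternating_words:
  assumes "class_alternating V w" "set w \<subseteq> A" "length w \<ge> m"
  shows "(take m w, drop (length w - m) w)
    \<in> (arcs_ends (overlap_digraph (class_alternating_words (Suc m) A V)))\<^sup>*"
  using assms
proof (induction w)
  case (Cons a w)
  let ?R = "arcs_ends (overlap_digraph (class_alternating_words (Suc m) A V))"
  show ?case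
  proof (cases "length w \<ge> m")
    case True
    have "class_alternating V (take (Suc m) (a # w))"
      using Cons.prems class_alternating_append[of V "take (Suc m) (a # w)" "drop (Suc m) (a # w)"]
      by simp
    then have "take (Suc m) (a # w) \<in> class_alternating_words (Suc m) A V"
      using Cons.prems True by (auto simp: class_alternating_words_def dest: in_set_takeD)
    moreover have "butlast (take (Suc m) (a # w)) = take m (a # w)"
      using True by (subst butlast_take) auto
    moreover have "tl (take (Suc m) (a # w)) = take m w" by simp
    ultimately have "(take m (a # w), take m w) \<in> ?R"
      by (force simp: arcs_ends_conv image_iff)
    moreover have "(take m w, drop (length w - m) w) \<in> ?R\<^sup>*"
      using Cons True by (auto simp: class_alternating_Cons)
    ultimately show ?thesis
      using True by (simp add: Suc_diff_le)
  next
    \<comment> \<open>Now \<open>a # w\<close> has length exactly \<open>m\<close>, and the window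
      already covers it.\<close>
    case False
    then show ?thesis using Cons.prems by simp
  qed
qed simp

lemma strongly_connected_class_alternating_words:
  assumes ne: "class_alternating_words (Suc m) A V \<noteq> {}" and "finite A"
  shows "strongly_connected (overlap_digraph (class_alternating_words (Suc m) A V))"
proof -
  let ?W = "class_alternating_words (Suc m) A V"
  interpret G: fin_digraph "overlap_digraph ?W"
    using assms by (intro fin_digraph_overlap_digraph finite_class_alternating_words)
  have "u \<rightarrow>\<^sup>*\<^bsub>overlap_digraph ?W\<^esub> v"
    if u: "u \<in> verts (overlap_digraph ?W)" and v: "v \<in> verts (overlap_digraph ?W)" for u v
  proof -
    have uw: "u \<in> class_alternating_words m A V" and vw: "v \<in> class_alternating_words m A V"
      using verts_overlap_digraph_class_alternating_words u v
      unfolding overlap_digraph_simps by blast+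
    have "\<exists>c. set c \<subseteq> A \<and> class_alternating V (u @ c @ v)"
    \<comment> \<open>For \<open>m = 0\<close> both words are empty, and \<open>last u\<close> and
      \<open>hd v\<close> carry no information.\<close>
    proof (cases "m = 0 \<or> (last u \<in> V) \<noteq> (hd v \<in> V)")
      case True
      then have "class_alternating V (u @ [] @ v)"
        using uw vw by (auto simp: class_alternating_words_def class_alternating_append)
      then show ?thesis by (intro exI[of _ "[]"]) simp
    next
      case False
      \<comment> \<open>The first two letters of any word in \<open>?W\<close> represent both
        classes, so one of them can separate \<open>u\<close> from \<open>v\<close>.\<close>
      from ne obtain w where w: "w \<in> ?W" by auto
      moreover from False obtain m' where "m = Suc m'" using not0_implies_Suc by blast
      ultimately obtain a b w' where "w = a # b # w'"
        by (auto simp: class_alternating_words_def length_Suc_conv)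
      with w have "a \<in> A" "b \<in> A" "(a \<in> V) \<noteq> (b \<in> V)"
        by (simp_all add: class_alternating_words_def class_alternating_Cons)
      then obtain c where "c \<in> A" "(c \<in> V) \<noteq> (last u \<in> V)" by blast
      with False uw vw have "class_alternating V (u @ [c] @ v)"
        by (auto simp: class_alternating_words_def class_alternating_append class_alternating_Cons)
      with \<open>c \<in> A\<close> show ?thesis by (intro exI[of _ "[c]"]) simp
    qed
    then obtain c where "set c \<subseteq> A" "class_alternating V (u @ c @ v)" by blast
    with overlap_walk_class_alternating_words[of V "u @ c @ v" A m] uw vw
    have "(u, v) \<in> (arcs_ends (overlap_digraph ?W))\<^sup>*"
      by (simp add: class_alternating_words_def)
    with u show ?thesis by (simp only: G.reachable_conv')
  qed
  with ne show ?thesis by (simp add: strongly_connected_def)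
qed

lemma class_alternating_words_balanced:
  assumes "V \<inter> C = {}" and bal: "even m \<Longrightarrow> card V = card C"
    and u: "u \<in> class_alternating_words m (V \<union> C) V"
  shows "card {a. a # u \<in> class_alternating_words (Suc m) (V \<union> C) V} =
    card {b. u @ [b] \<in> class_alternating_words (Suc m) (V \<union> C) V}"
\<comment> \<open>For the empty word, both sides count the one-letter words.\<close>
proof (cases "u = []")
  case True
  then show ?thesis by simp
next
  case False
  \<comment> \<open>The letters that may be put next to \<open>x\<close> form the whole opposite
    class. By parity, the two ends of \<open>u\<close> have the same opposite class if
    \<open>m\<close> is odd; if \<open>m\<close> is even, the classes differ and \<open>bal\<close>
    equates their sizes.\<close>
  let ?opp = "\<lambda>x. if x \<in> V then C else V"
  have "{a. a # u \<in> class_alternating_words (Suc m) (V \<union> C) V} = ?opp (hd u)"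
    using u False \<open>V \<inter> C = {}\<close>
    by (auto simp: class_alternating_words_def class_alternating_Cons)
  moreover have "{b. u @ [b] \<in> class_alternating_words (Suc m) (V \<union> C) V} = ?opp (last u)"
    using u False \<open>V \<inter> C = {}\<close>
    by (auto simp: class_alternating_words_def class_alternating_append class_alternating_Cons)
  moreover have "((hd u \<in> V) = (last u \<in> V)) = odd m"
    using u False class_alternating_hd_last by (auto simp: class_alternating_words_def)
  ultimately show ?thesis using bal by auto
qed

theorem theorem4:
  fixes n k\<^sub>v k\<^sub>c :: nat and A V C :: "'a set"
  assumes "n > 0"
    and "finite A" and "A = V \<union> C" and "V \<inter> C = {}"
    and "card V = k\<^sub>v" and "card C = k\<^sub>c"
    and "even n \<or> (odd n \<and> k\<^sub>v = k\<^sub>c)"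
  shows "\<exists>xs. universal_cycle n (class_alternating_words n A V) xs"
proof -
  from \<open>n > 0\<close> obtain m where n: "n = Suc m" by (cases n) auto
  show ?thesis
  proof (rule universal_cycle_exists)
    fix u assume "u \<in> butlast ` class_alternating_words n A V \<union> tl ` class_alternating_words n A V"
    then have "u \<in> class_alternating_words m A V"
      using verts_overlap_digraph_class_alternating_words n by blast
    then show "card {a. a # u \<in> class_alternating_words n A V} =
        card {b. u @ [b] \<in> class_alternating_words n A V}"
      using assms n class_alternating_words_balanced[of V C m u] by auto
  next
    show "length w = n" if "w \<in> class_alternating_words n A V" for w
      using that by (simp add: class_alternating_words_def)
  qed (use assms n in \<open>simp_all add: finite_class_alternating_words
      strongly_connected_class_alternating_words\<close>)
qed

end
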